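(* Let $$\pi_k^\ast\in\arg\min_{\pi_k\in\Pi_k}\Big\{\min_{p\in\mathbb{P}_\ell(0)}\sum_{i\in\bar\pi_k}\frac{\eta_i^2}{\lambda_i}p(\lambda_i)^2\Big\},$$ and let $\hat p_\ell\in\mathbb{P}_\ell(0)$, with a positive root $\theta^\ast>0$, be such that $$\{\hat p_\ell\}=\arg\min_{p\in\mathbb{P}_\ell(0)}\sum_{i\in\bar\pi_k^\ast}\frac{\eta_i^2}{\lambda_i}p(\lambda_i)^2 .$$ Then $d^\ast=(d_1^\ast,\dots,d_n^\ast)$, where $d_i^\ast=\frac{\theta^\ast}{\lambda_i}-1$ if $i\in\pi_k^\ast$ and $d_i^\ast=0$ if $i\in\bar\pi_k^\ast$, solves the optimization problem $$\min_{(d_1,\dots,d_n)\in\mathbb{R}^n}\ \tfrac12\|x^\ast-\hat x_\ell(F)\|_A^2\quad\text{s.t.}\quad F=I_n+SDS^\top,\ D=\mathrm{diag}(d_1,\dots,d_n),\ I_n+D\text{ positive definite},\ \mathrm{rank}(D)\le k.$$ In addition, with $F^\ast:=I_n+SD^\ast S^\top$ and $D^\ast=\mathrm{diag}(d_1^\ast,\dots,d_n^\ast)$, $$\|x^\ast-\hat x_\ell(F^\ast)\|_A^2=\sum_{i\in\bar\pi_k^\ast}\frac{\eta_i^2}{\lambda_i}\hat p_\ell(\lambda_i)^2 .$$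
   Context: $A\in\mathbb{R}^{n\times n}$ is symmetric positive definite with spectral decomposition $A=S\Lambda S^\top$, $\Lambda=\mathrm{diag}(\lambda_1,\dots,\lambda_n)$, $\lambda_1\ge\dots\ge\lambda_n>0$, $S=[s_1\ \cdots\ s_n]$ orthogonal. $b\in\mathbb{R}^n$, $x^\ast=A^{-1}b$, $x_0\in\mathbb{R}^n$ is an initial guess, $r_0=b-Ax_0$, $\eta_i=s_i^\top r_0$. $\|x\|_A=\sqrt{x^\top A x}$. $\mathbb{P}_\ell(0)$ is the set of real polynomials of degree at most $\ell$ with value $1$ at $0$. $k$ is an integer with $1<k<n$. $\Pi_k=\{\pi_k\subset\{1,\dots,n\}: |\pi_k|=k\}$ and a bar denotes the complement in $\{1,\dots,n\}$. Exact arithmetic is assumed. Feasible preconditioner: $F=I_n+SDS^\top$ with $D=\mathrm{diag}(d_1,\dots,d_n)$ real, $I_n+D$ positive definite and $\mathrm{rank}(D)\le k$. $\mathbf{PCG}(F)$ is the preconditioned conjugate gradient method for $Ax=b$ with preconditioner $F$: $\hat x_0=x_0$, $\hat r_0=b-A\hat x_0$, $z_0=F\hat r_0$, $\hat\rho_0=\hat r_0^\top z_0$, $\hat p_0=z_0$, and for $\ell=0,1,\dots$: $\hat q_\ell=A\hat p_\ell$, $\hat\alpha_\ell=\hat\rho_\ell/(\hat q_\ell^\top\hat p_\ell)$, $\hat x_{\ell+1}=\hat x_\ell+\hat\alpha_\ell\hat p_\ell$, $\hat r_{\ell+1}=\hat r_\ell-\hat\alpha_\ell\hat q_\ell$, $z_{\ell+1}=F\hat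 r_{\ell+1}$, $\hat\rho_{\ell+1}=\hat r_{\ell+1}^\top z_{\ell+1}$, $\hat\beta_{\ell+1}=\hat\rho_{\ell+1}/\hat\rho_\ell$, $\hat p_{\ell+1}=z_{\ell+1}+\hat\beta_{\ell+1}\hat p_\ell$; it stops once the solution is reached. (Vectors $\hat p_\ell$ in this recurrence are search directions; in the claim $\hat p_\ell$ is a polynomial.) $\hat x_\ell(F)$ denotes its $\ell$-th iterate. Standing assumption: $\ell\ge1$ is fixed and, for every feasible $F$, $\mathbf{PCG}(F)$ has not reached the solution at iteration $\ell$ (the iterates up to $\ell$ are defined and $\hat x_j(F)\ne x^\ast$ for $j\le\ell$). *)

theory Defs
  imports "HOL-Analysis.Analysis" "HOL-Computational_Algebra.Polynomial"
begin

definition diag :: "real ^ 'n \<Rightarrow> real ^ 'n ^ 'n"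
  where "diag d = (\<chi> i j. if i = j then d $ i else 0)"

definition sym_posdef :: "real ^ 'n ^ 'n \<Rightarrow> bool"
  where "sym_posdef M \<longleftrightarrow> transpose M = M \<and> (\<forall>x. x \<noteq> 0 \<longrightarrow> 0 < x \<bullet> (M *v x))"

definition energy_norm :: "real ^ 'n ^ 'n \<Rightarrow> real ^ 'n \<Rightarrow> real"
  where "energy_norm A x = sqrt (x \<bullet> (A *v x))"

definition normalized_polys :: "nat \<Rightarrow> real poly set"
  where "normalized_polys l = {p. degree p \<le> l \<and> poly p 0 = 1}"

definition spectral_cost ::
    "real ^ 'n \<Rightarrow> ('n \<Rightarrow> real) \<Rightarrow> 'n set \<Rightarrow> real poly \<Rightarrow> real"
  where "spectral_cost lam eta I p = (\<Sum>i\<in>I. (eta i)\<^sup>2 / lam $ i * (poly p (lam $ i))\<^sup>2)"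

text \<open>Unspecified when the minimum is not attained; for the spectral cost over
  \<^const>\<open>normalized_polys\<close> it always is, see \<open>spectral_cost_attains_min\<close> below.\<close>

definition min_value :: "('a \<Rightarrow> real) \<Rightarrow> 'a set \<Rightarrow> real"
  where "min_value f X = (LEAST v. v \<in> f ` X)"

definition precond :: "real ^ 'n ^ 'n \<Rightarrow> real ^ 'n \<Rightarrow> real ^ 'n ^ 'n"
  where "precond S d = mat 1 + S ** diag d ** transpose S"

definition feasible :: "nat \<Rightarrow> real ^ 'n \<Rightarrow> bool"
  where "feasible k d \<longleftrightarrow> sym_posdef (mat 1 + diag d) \<and> rank (diag d) \<le> k"

text \<open>A state of the preconditioned conjugate gradient method consists of the iterate \<open>x\<close>, the
  residual \<open>r\<close>, the scalar \<open>\<rho> = r \<bullet> (F *v r)\<close> and the search direction \<open>p\<close>.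
  Once the solution is reached the method stops, which is modelled by a constant state.
  As long as it is not reached, and \<open>A\<close> and \<open>F\<close> are symmetric positive definite, the
  denominators \<open>q \<bullet> p\<close> and \<open>\<rho>\<close> are nonzero.\<close>

type_synonym 'n pcg_state = "(real ^ 'n) \<times> (real ^ 'n) \<times> real \<times> (real ^ 'n)"

definition pcg_init ::
    "real ^ 'n ^ 'n \<Rightarrow> real ^ 'n ^ 'n \<Rightarrow> real ^ 'n \<Rightarrow> real ^ 'n \<Rightarrow> 'n pcg_state"
  where "pcg_init A F b x0 =
    (let r = b - A *v x0; z = F *v r in (x0, r, r \<bullet> z, z))"

definition pcg_step ::
    "real ^ 'n ^ 'n \<Rightarrow> real ^ 'n ^ 'n \<Rightarrow> real ^ 'n \<Rightarrow> 'n pcg_state \<Rightarrow> 'n pcg_state"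
  where "pcg_step A F b = (\<lambda>(x, r, \<rho>, p).
    if A *v x = b then (x, r, \<rho>, p)
    else
      let q = A *v p;
          \<alpha> = \<rho> / (q \<bullet> p);
          x' = x + \<alpha> *\<^sub>R p;
          r' = r - \<alpha> *\<^sub>R q;
          z' = F *v r';
          \<rho>' = r' \<bullet> z';
          \<beta> = \<rho>' / \<rho>
      in (x', r', \<rho>', z' + \<beta> *\<^sub>R p))"

definition pcg_iterate ::
    "real ^ 'n ^ 'n \<Rightarrow> real ^ 'n ^ 'n \<Rightarrow> real ^ 'n \<Rightarrow> real ^ 'n \<Rightarrow> nat \<Rightarrow> real ^ 'n"
  where "pcg_iterate A F b x0 l = fst ((pcg_step A F b ^^ l) (pcg_init A F b x0))"

lemma spectral_cost_attains_min:
  fixes lam :: "real ^ 'n"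
  assumes pos: "\<And>i. 0 < lam $ i"
  shows "\<exists>p. is_arg_min (spectral_cost lam eta I) (\<lambda>p. p \<in> normalized_polys l) p"
proof -
  define w where "w i = (if i \<in> I then sqrt ((eta i)\<^sup>2 / lam $ i) else 0)" for i
  define ev where "ev p = (\<chi> i. w i * poly p (lam $ i))" for p
  define V where "V = ev ` {p. degree p \<le> l \<and> poly p 0 = 0}"
  have w2: "(w i)\<^sup>2 = (if i \<in> I then (eta i)\<^sup>2 / lam $ i else 0)" for i
    using pos[of i] by (simp add: w_def)
  have ev_cost: "spectral_cost lam eta I p = (norm (ev p))\<^sup>2" for p
  proof -
    have "(norm (ev p))\<^sup>2 = (\<Sum>i\<in>UNIV. (w i)\<^sup>2 * (poly p (lam $ i))\<^sup>2)"
      by (simp add: ev_def norm_vec_def L2_set_def sum_nonneg power_mult_distrib)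
    also have "\<dots> = (\<Sum>i\<in>UNIV. if i \<in> I then (eta i)\<^sup>2 / lam $ i * (poly p (lam $ i))\<^sup>2 else 0)"
      by (rule sum.cong) (simp_all add: w2)
    also have "\<dots> = spectral_cost lam eta I p"
      by (simp add: spectral_cost_def sum.If_cases)
    finally show ?thesis by simp
  qed
  have lin: "ev (p + q) = ev p + ev q" "ev (smult c p) = c *\<^sub>R ev p" "ev 0 = 0" for p q c
    by (simp_all add: ev_def vec_eq_iff algebra_simps)
  have "subspace V"
    unfolding subspace_def
  proof (intro conjI ballI allI)
    show "0 \<in> V"
      unfolding V_def by (rule image_eqI[where x = 0]) (simp_all add: lin)
  next
    fix x y assume "x \<in> V" "y \<in> V"
    then obtain p q where "x = ev p" "degree p \<le> l" "poly p 0 = 0"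
      "y = ev q" "degree q \<le> l" "poly q 0 = 0"
      by (auto simp: V_def)
    then show "x + y \<in> V"
      unfolding V_def by (intro image_eqI[where x = "p + q"]) (auto simp: lin intro: degree_add_le)
  next
    fix c x assume "x \<in> V"
    then obtain p where "x = ev p" "degree p \<le> l" "poly p 0 = 0"
      by (auto simp: V_def)
    then show "c *\<^sub>R x \<in> V"
      unfolding V_def
      by (intro image_eqI[where x = "smult c p"]) (auto simp: lin intro: order_trans[OF degree_smult_le])
  qed
  then have "closed V" by (rule closed_subspace)
  moreover have "V \<noteq> {}" using \<open>subspace V\<close> subspace_0 by blast
  ultimately obtain v where v: "v \<in> V" "\<And>y. y \<in> V \<Longrightarrow> dist (- ev 1) v \<le> dist (- ev 1) y"
    by (rule distance_attains_inf[where a = "- ev 1"]) blast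
  have dist: "dist (- ev 1) (ev q) = norm (ev (1 + q))" for q
    by (simp add: dist_norm lin norm_minus_commute add.commute)
  from v(1) obtain q where q: "v = ev q" "degree q \<le> l" "poly q 0 = 0"
    by (auto simp: V_def)
  have "1 + q \<in> normalized_polys l"
    using q by (auto simp: normalized_polys_def intro: degree_add_le)
  moreover have "spectral_cost lam eta I (1 + q) \<le> spectral_cost lam eta I p"
    if p: "p \<in> normalized_polys l" for p
  proof -
    have "p - 1 \<in> {p. degree p \<le> l \<and> poly p 0 = 0}"
      using p by (auto simp: normalized_polys_def intro: degree_diff_le)
    then have "dist (- ev 1) v \<le> dist (- ev 1) (ev (p - 1))"
      by (intro v(2)) (simp add: V_def)
    then show ?thesis
      by (simp add: ev_cost q dist)
  qed
  ultimately show ?thesis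
    by (auto simp: is_arg_min_linorder)
qed

end

theory Submission
  imports Defs
begin

text \<open>The error of the preconditioned conjugate gradient method has a polynomial description. After
  \<open>l\<close> steps the iterate minimizes the energy norm of the error over \<open>x0\<close> plus the Krylov space
  of \<open>F A\<close>, that is, the error is \<open>q(F A)\<close> applied to the initial error, for the best \<open>q\<close> of
  degree at most \<open>l\<close> with \<open>q(0) = 1\<close> (\<open>iterate_minimizes_energy\<close>, \<open>krylov_iff_normalized_poly\<close>).
  Here \<open>F\<close> and \<open>A\<close> have the columns of \<open>S\<close> as common eigenvectors, so \<open>F A\<close> has eigenvalues
  \<open>(1 + d\<^sub>i) \<lambda>\<^sub>i\<close>, and the squared error is the minimum over \<open>q\<close> of
  \<open>\<Sum>\<^sub>i \<eta>\<^sub>i\<^sup>2 / \<lambda>\<^sub>i q((1 + d\<^sub>i) \<lambda>\<^sub>i)\<^sup>2\<close> (\<open>pcg_error_is_minimal_cost\<close>).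

  A feasible \<open>d\<close> moves at most \<open>k\<close> eigenvalues. Dropping the terms of a \<open>k\<close>-element set that
  contains the moved indices leaves a sum over unmoved eigenvalues, which bounds the error from
  below by the value of the combinatorial problem solved by \<open>\<pi>\<^sup>*\<close>. The bound is attained: \<open>d\<^sup>*\<close>
  moves all eigenvalues indexed by \<open>\<pi>\<^sup>*\<close> to the root \<open>\<theta>\<^sup>*\<close> of the optimal polynomial for
  the remaining ones, so these terms vanish for that polynomial. Positivity of \<open>\<theta>\<^sup>*\<close> is
  what makes \<open>d\<^sup>*\<close> feasible.\<close>

section \<open>Optimality of conjugate gradients\<close>

lemma image_span_subset:
  assumes "linear f" "\<And>v. v \<in> B \<Longrightarrow> f v \<in> span C" "u \<in> span B"
  shows "f u \<in> span C"
  using assms span_minimal[of "f ` B" "span C"] linear_span_image[OF assms(1), of B] by auto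

text \<open>The first \<open>m\<close> steps of the method as sequences in an inner product space. The
  points before step \<open>m\<close> differ from the solution, which keeps all denominators nonzero.\<close>

locale pcg_run =
  fixes A F :: "'a::real_inner \<Rightarrow> 'a"
    and sol :: 'a
    and x r p :: "nat \<Rightarrow> 'a"
    and m :: nat
  assumes linear_A: "linear A"
    and linear_F: "linear F"
    and self_adjoint_A: "A u \<bullet> v = u \<bullet> A v"
    and self_adjoint_F: "F u \<bullet> v = u \<bullet> F v"
    and pos_A: "v \<noteq> 0 \<Longrightarrow> 0 < v \<bullet> A v"
    and pos_F: "v \<noteq> 0 \<Longrightarrow> 0 < v \<bullet> F v"
    and residual: "r j = A (sol - x j)"
    and not_solved: "j < m \<Longrightarrow> x j \<noteq> sol"
    and p_0: "p 0 = F (r 0)"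
    and x_Suc: "j < m \<Longrightarrow> x (Suc j) = x j + ((r j \<bullet> F (r j)) / (A (p j) \<bullet> p j)) *\<^sub>R p j"
    and p_Suc: "j < m \<Longrightarrow> p (Suc j) =
      F (r (Suc j)) + ((r (Suc j) \<bullet> F (r (Suc j))) / (r j \<bullet> F (r j))) *\<^sub>R p j"
begin

abbreviation rho :: "nat \<Rightarrow> real"
  where "rho j \<equiv> r j \<bullet> F (r j)"

abbreviation alpha :: "nat \<Rightarrow> real"
  where "alpha j \<equiv> rho j / (A (p j) \<bullet> p j)"

abbreviation directions :: "nat \<Rightarrow> 'a set"
  where "directions j \<equiv> span (p ` {..<j})"

abbreviation krylov :: "nat \<Rightarrow> 'a set"
  where "krylov j \<equiv> span ((\<lambda>i. ((\<lambda>u. F (A u)) ^^ i) (F (r 0))) ` {..<j})"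

lemma rho_pos:
  assumes "j < m"
  shows "0 < rho j"
proof -
  have "sol - x j \<noteq> 0"
    using not_solved[OF assms] by simp
  then have "r j \<noteq> 0"
    using pos_A[of "sol - x j"] unfolding residual by fastforce
  then show ?thesis by (rule pos_F)
qed

lemma r_Suc:
  assumes "j < m"
  shows "r (Suc j) = r j - alpha j *\<^sub>R A (p j)"
proof -
  have "sol - x (Suc j) = (sol - x j) - alpha j *\<^sub>R p j"
    by (simp add: x_Suc[OF assms])
  then show ?thesis
    by (simp only: residual linear_diff[OF linear_A] linear_scale[OF linear_A])
qed

lemma directions_mono: "i \<le> j \<Longrightarrow> directions i \<subseteq> directions j"
  by (intro span_mono image_mono) auto

lemma krylov_mono: "i \<le> j \<Longrightarrow> krylov i \<subseteq> krylov j"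
  by (intro span_mono image_mono) auto

lemma direction_in_directions: "i < j \<Longrightarrow> p i \<in> directions j"
  by (intro span_base) auto

lemma preconditioned_residual_in_directions:
  assumes "j \<le> m"
  shows "F (r j) \<in> directions (Suc j)"
proof (cases j)
  case 0
  then show ?thesis by (metis p_0 direction_in_directions lessI)
next
  case (Suc i)
  then have "F (r j) = p j - (rho j / rho i) *\<^sub>R p i"
    using p_Suc[of i] assms by simp
  then show ?thesis
    using Suc by (metis direction_in_directions lessI less_SucI span_diff span_scale)
qed

text \<open>The relations have to be proved in one induction. Conjugacy of a new direction
  \<open>p (Suc k)\<close> to \<open>p i\<close> with \<open>i < k\<close> holds because \<open>A (p i)\<close> is a multiple of
  \<open>r i - r (Suc i)\<close>, and the new residual is orthogonal to \<open>F (r i)\<close> and \<open>F (r (Suc i))\<close>, which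
  are combinations of the directions up to \<open>p k\<close>. For \<open>i = k\<close> the term with \<open>r (Suc k)\<close> survives,
  and the coefficient of \<open>p k\<close> in the new direction cancels it.\<close>

lemma orthogonality_relations:
  assumes "j \<le> m"
  shows "(\<forall>i<j. r j \<bullet> p i = 0) \<and> (\<forall>i<j. A (p i) \<bullet> p j = 0) \<and> r j \<bullet> p j = rho j"
  using assms
proof (induction j rule: less_induct)
  case (less j)
  show ?case
  proof (cases j)
    case 0
    then show ?thesis by (simp add: p_0)
  next
    case (Suc k)
    then have k: "k < m" using less.prems by simp
    have old: "\<And>i. i < k \<Longrightarrow> r k \<bullet> p i = 0" "\<And>i. i < k \<Longrightarrow> A (p i) \<bullet> p k = 0"
      using less.IH[of k] Suc k by auto
    have res_p: "r i \<bullet> p i = rho i" if "i \<le> k" for i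
      using less.IH[of i] that Suc k by auto
    have curv: "0 < A (p i) \<bullet> p i" if "i \<le> k" for i
    proof -
      have "p i \<noteq> 0"
        using res_p[OF that] rho_pos[of i] that k by auto
      then show ?thesis by (metis pos_A inner_commute)
    qed
    have res_new: "r (Suc k) \<bullet> p i = 0" if "i \<le> k" for i
    proof (cases "i = k")
      case True
      then show ?thesis
        using curv[of k] by (simp add: r_Suc[OF k] inner_diff_left res_p)
    next
      case False
      then have "i < k" using that by simp
      moreover have "A (p k) \<bullet> p i = 0"
        using old(2)[OF \<open>i < k\<close>] by (metis self_adjoint_A inner_commute)
      ultimately show ?thesis
        by (simp add: r_Suc[OF k] inner_diff_left old)
    qed
    have res_new_directions: "r (Suc k) \<bullet> v = 0" if "v \<in> directions (Suc k)" for v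
      using that
      by (rule span_induct[where P = "\<lambda>v. r (Suc k) \<bullet> v = 0"])
        (auto simp: subspace_def inner_add_right res_new)
    have res_p_new: "r (Suc k) \<bullet> p (Suc k) = rho (Suc k)"
      by (simp add: p_Suc[OF k] inner_add_right res_new)
    have difference: "alpha i * (A (p i) \<bullet> v) = r i \<bullet> v - r (Suc i) \<bullet> v" if "i \<le> k" for i v
      using r_Suc[of i] that k by (simp add: inner_diff_left)
    have conj_new: "A (p i) \<bullet> p (Suc k) = 0" if "i \<le> k" for i
    proof -
      have "F (r i) \<in> directions (Suc k)"
        using preconditioned_residual_in_directions[of i] directions_mono[of "Suc i" "Suc k"] that k
        by auto
      then have old_res: "r i \<bullet> F (r (Suc k)) = 0"
        using res_new_directions[of "F (r i)"] by (metis inner_commute self_adjoint_F)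
      show ?thesis
      proof (cases "i = k")
        case True
        have "alpha k * (A (p k) \<bullet> F (r (Suc k))) = - rho (Suc k)"
          using difference[of k "F (r (Suc k))"] old_res True by simp
        then show ?thesis
          using True curv[of k] rho_pos[OF k]
          by (simp add: p_Suc[OF k] inner_add_right field_simps)
      next
        case False
        then have i: "i < k" using that by simp
        have "F (r (Suc i)) \<in> directions (Suc k)"
          using preconditioned_residual_in_directions[of "Suc i"]
            directions_mono[of "Suc (Suc i)" "Suc k"] i k by auto
        then have "r (Suc i) \<bullet> F (r (Suc k)) = 0"
          using res_new_directions[of "F (r (Suc i))"] by (metis inner_commute self_adjoint_F)
        then have "alpha i * (A (p i) \<bullet> F (r (Suc k))) = 0"
          using difference[OF that, of "F (r (Suc k))"] old_res by simp
        moreover have "alpha i \<noteq> 0"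
          using curv[OF that] rho_pos[of i] i k by simp
        ultimately have "A (p i) \<bullet> F (r (Suc k)) = 0"
          by (simp only: mult_eq_0_iff) simp
        then show ?thesis
          using old(2)[OF i] by (simp add: p_Suc[OF k] inner_add_right)
      qed
    qed
    show ?thesis
      using Suc res_new conj_new res_p_new by (auto simp: less_Suc_eq_le)
  qed
qed

lemma curvature_pos:
  assumes "j < m"
  shows "0 < A (p j) \<bullet> p j"
proof -
  have "r j \<bullet> p j = rho j"
    using orthogonality_relations[of j] assms by simp
  then have "p j \<noteq> 0"
    using rho_pos[OF assms] by auto
  then show ?thesis by (metis pos_A inner_commute)
qed

lemma linear_FA: "linear (\<lambda>u. F (A u))"
  using linear_compose[OF linear_A linear_F] by (simp add: o_def)

text \<open>By the residual recurrence, \<open>F (A (p i))\<close> is a multiple of the difference of two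
  consecutive preconditioned residuals; this divides by the step length, which is nonzero as long
  as the solution has not been reached.\<close>

lemma operator_on_directions:
  assumes "j \<le> m" "v \<in> directions j"
  shows "F (A v) \<in> directions (Suc j)"
proof (rule image_span_subset[OF linear_FA _ assms(2)])
  fix v assume "v \<in> p ` {..<j}"
  then obtain i where i: "v = p i" "i < j" by auto
  then have "i < m" using assms(1) by simp
  have "A (p i) = (1 / alpha i) *\<^sub>R (r i - r (Suc i))"
    using curvature_pos[OF \<open>i < m\<close>] rho_pos[OF \<open>i < m\<close>] by (simp add: r_Suc[OF \<open>i < m\<close>])
  then have "F (A v) = (1 / alpha i) *\<^sub>R (F (r i) - F (r (Suc i)))"
    using i(1) by (metis linear_diff[OF linear_F] linear_scale[OF linear_F])
  moreover have "F (r i) \<in> directions (Suc j)" "F (r (Suc i)) \<in> directions (Suc j)"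
    using preconditioned_residual_in_directions[of i] directions_mono[of "Suc i" "Suc j"]
      preconditioned_residual_in_directions[of "Suc i"] directions_mono[of "Suc (Suc i)" "Suc j"]
      i \<open>i < m\<close> by auto
  ultimately show "F (A v) \<in> directions (Suc j)"
    by (auto intro: span_diff span_scale)
qed

lemma operator_on_krylov:
  assumes "v \<in> krylov j"
  shows "F (A v) \<in> krylov (Suc j)"
proof (rule image_span_subset[OF linear_FA _ assms])
  fix v assume "v \<in> (\<lambda>i. ((\<lambda>u. F (A u)) ^^ i) (F (r 0))) ` {..<j}"
  then obtain i where "v = ((\<lambda>u. F (A u)) ^^ i) (F (r 0))" "i < j" by auto
  then show "F (A v) \<in> krylov (Suc j)"
    by (intro span_base image_eqI[of _ _ "Suc i"]) auto
qed

lemma direction_in_krylov: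
  assumes "j \<le> m"
  shows "F (r j) \<in> krylov (Suc j) \<and> p j \<in> krylov (Suc j)"
  using assms
proof (induction j)
  case 0
  have "F (r 0) \<in> krylov (Suc 0)"
    by (intro span_base) simp
  then show ?case by (simp add: p_0)
next
  case (Suc j)
  then have j: "j < m" and old: "F (r j) \<in> krylov (Suc j)" "p j \<in> krylov (Suc j)"
    by auto
  have "F (r (Suc j)) = F (r j) - alpha j *\<^sub>R F (A (p j))"
    by (simp only: r_Suc[OF j] linear_diff[OF linear_F] linear_scale[OF linear_F])
  moreover have "F (A (p j)) \<in> krylov (Suc (Suc j))"
    by (rule operator_on_krylov[OF old(2)])
  moreover have "F (r j) \<in> krylov (Suc (Suc j))" "p j \<in> krylov (Suc (Suc j))"
    using old krylov_mono[of "Suc j" "Suc (Suc j)"] by auto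
  ultimately show ?case
    by (auto simp: p_Suc[OF j] intro!: span_diff span_add span_scale)
qed

text \<open>Each of the two families starts with \<open>F (r 0)\<close>, and \<open>F A\<close> maps the span of the first
  \<open>j\<close> members of either family into the span of its first \<open>Suc j\<close> members.\<close>

lemma directions_eq_krylov: "directions m = krylov m"
proof
  show "directions m \<subseteq> krylov m"
  proof (rule span_minimal)
    show "p ` {..<m} \<subseteq> krylov m"
    proof
      fix v assume "v \<in> p ` {..<m}"
      then obtain j where "v = p j" "j < m" by auto
      then show "v \<in> krylov m"
        using direction_in_krylov[of j] krylov_mono[of "Suc j" m] by auto
    qed
  qed simp
  have power: "((\<lambda>u. F (A u)) ^^ j) (F (r 0)) \<in> directions (Suc j)" if "j < m" for j
    using that
  proof (induction j)
    case 0
    show ?case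
      using preconditioned_residual_in_directions[of 0] by simp
  next
    case (Suc j)
    then show ?case
      using operator_on_directions[of "Suc j" "((\<lambda>u. F (A u)) ^^ j) (F (r 0))"] by simp
  qed
  show "krylov m \<subseteq> directions m"
  proof (rule span_minimal)
    show "(\<lambda>i. ((\<lambda>u. F (A u)) ^^ i) (F (r 0))) ` {..<m} \<subseteq> directions m"
    proof
      fix v assume "v \<in> (\<lambda>i. ((\<lambda>u. F (A u)) ^^ i) (F (r 0))) ` {..<m}"
      then obtain j where "v = ((\<lambda>u. F (A u)) ^^ j) (F (r 0))" "j < m" by auto
      then show "v \<in> directions m"
        using power[of j] directions_mono[of "Suc j" m] by auto
    qed
  qed simp
qed

lemma iterate_in_directions: "j \<le> m \<Longrightarrow> x j - x 0 \<in> directions j"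
proof (induction j)
  case (Suc j)
  have "x (Suc j) - x 0 = (x j - x 0) + alpha j *\<^sub>R p j"
    using Suc.prems by (simp add: x_Suc)
  moreover have "x j - x 0 \<in> directions (Suc j)"
    using Suc directions_mono[of j "Suc j"] by auto
  ultimately show ?case
    by (metis direction_in_directions lessI span_add span_scale)
qed (simp add: span_zero)

theorem iterate_in_krylov: "x m - x 0 \<in> krylov m"
  using iterate_in_directions[of m] directions_eq_krylov by simp

text \<open>This is Pythagoras in the energy inner product: the residual \<open>r m = A (sol - x m)\<close> is orthogonal
  to all directions and therefore to \<open>x m - v\<close>, so the error at \<open>v\<close> splits without a cross term.\<close>

theorem iterate_minimizes_energy:
  assumes "v - x 0 \<in> krylov m"
  shows "(sol - x m) \<bullet> A (sol - x m) \<le> (sol - v) \<bullet> A (sol - v)"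
proof -
  define w where "w = x m - v"
  have "w = (x m - x 0) - (v - x 0)"
    by (simp add: w_def)
  then have "w \<in> directions m"
    using span_diff[OF iterate_in_directions[of m] assms[folded directions_eq_krylov]] by simp
  then have "r m \<bullet> w = 0"
    by (rule span_induct[where P = "\<lambda>w. r m \<bullet> w = 0"])
      (use orthogonality_relations[of m] in \<open>auto simp: subspace_def inner_add_right\<close>)
  then have cross: "A (sol - x m) \<bullet> w = 0"
    by (simp add: residual)
  have "sol - v = (sol - x m) + w"
    by (simp add: w_def)
  then have "(sol - v) \<bullet> A (sol - v) = ((sol - x m) + w) \<bullet> (A (sol - x m) + A w)"
    by (simp only: linear_add[OF linear_A])
  also have "\<dots> = (sol - x m) \<bullet> A (sol - x m) + w \<bullet> A w"
    using cross self_adjoint_A[of "sol - x m" w] inner_commute[of w "A (sol - x m)"]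
    by (simp add: inner_add_left inner_add_right)
  also have "\<dots> \<ge> (sol - x m) \<bullet> A (sol - x m)"
    using pos_A[of w] by (cases "w = 0") auto
  finally show ?thesis .
qed

end

section \<open>Krylov spaces in spectral coordinates\<close>

text \<open>The numbers \<open>column i S \<bullet> v\<close> are the coordinates of \<open>v\<close> in the orthonormal basis of columns
  of \<open>S\<close>. For \<open>v = r0\<close> they are the \<open>\<eta>\<^sub>i\<close>.\<close>

lemma column_inner: "column i S \<bullet> v = (v v* S) $ i"
  for S :: "real ^ 'n ^ 'm"
  by (simp add: column_def inner_vec_def vector_matrix_mult_def mult.commute)

lemma inner_spectral_coordinates:
  fixes S :: "real ^ 'n ^ 'n"
  assumes "orthogonal_matrix S"
  shows "u \<bullet> v = (\<Sum>i\<in>UNIV. (column i S \<bullet> u) * (column i S \<bullet> v))"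
proof -
  have "u \<bullet> v = u \<bullet> (S *v (transpose S *v v))"
    using assms by (simp add: orthogonal_matrix_def matrix_vector_mul_assoc
        del: transpose_matrix_vector)
  also have "\<dots> = (u v* S) \<bullet> (v v* S)"
    by (simp add: dot_lmul_matrix)
  finally show ?thesis
    by (simp only: column_inner) (simp add: inner_vec_def)
qed

lemma spectral_coordinates_eqI:
  fixes S :: "real ^ 'n ^ 'n"
  assumes "orthogonal_matrix S" "\<And>i. column i S \<bullet> u = column i S \<bullet> v"
  shows "u = v"
proof -
  have "(u - v) \<bullet> (u - v) = 0"
    by (simp add: inner_spectral_coordinates[OF assms(1), of "u - v"] inner_diff_right assms(2))
  then show ?thesis by simp
qed

lemma spectral_coordinates_mult_vec:
  fixes S :: "real ^ 'n ^ 'n"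
  assumes "orthogonal_matrix S"
  shows "column i S \<bullet> (S *v c) = c $ i"
proof -
  have "transpose S *v (S *v c) = c"
    using assms by (simp add: orthogonal_matrix_def matrix_vector_mul_assoc
        del: transpose_matrix_vector)
  then show ?thesis
    by (simp add: column_inner)
qed

lemma diag_mult_vec: "(diag d *v v) $ i = d $ i * v $ i"
  by (simp add: diag_def matrix_vector_mult_def if_distrib if_distribR cong: if_cong)

lemma spectral_coordinates_conjugated_diag:
  fixes S :: "real ^ 'n ^ 'n"
  assumes "orthogonal_matrix S"
  shows "column i S \<bullet> ((S ** diag d ** transpose S) *v v) = d $ i * (column i S \<bullet> v)"
proof -
  have "transpose S *v ((S ** diag d ** transpose S) *v v)
      = (transpose S ** S) *v (diag d *v (transpose S *v v))"
    by (simp add: matrix_vector_mul_assoc matrix_mul_assoc del: transpose_matrix_vector)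
  then have "((S ** diag d ** transpose S) *v v) v* S = diag d *v (v v* S)"
    using assms by (simp add: orthogonal_matrix_def)
  then show ?thesis
    by (simp add: column_inner diag_mult_vec)
qed

lemma spectral_coordinates_precond:
  fixes S :: "real ^ 'n ^ 'n"
  assumes "orthogonal_matrix S"
  shows "column i S \<bullet> (precond S d *v v) = (1 + d $ i) * (column i S \<bullet> v)"
  by (simp add: precond_def matrix_vector_mult_add_rdistrib inner_add_right
      spectral_coordinates_conjugated_diag[OF assms] distrib_right)

text \<open>Polynomials with value \<open>1\<close> at \<open>0\<close> are those of the form \<open>1 - t g(t)\<close>; subtracting \<open>g(G) (G e)\<close>
  from \<open>e\<close> therefore multiplies the coordinates of \<open>e\<close> by the values of such a polynomial at
  the eigenvalues \<open>mu\<close> of \<open>G\<close>. With \<open>e\<close> the initial error, this turns minimization over the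
  Krylov space into minimization over polynomials.\<close>

lemma krylov_iff_normalized_poly:
  fixes S :: "real ^ 'n ^ 'n"
  assumes S: "orthogonal_matrix S"
    and G: "\<And>v i. column i S \<bullet> G v = mu i * (column i S \<bullet> v)"
  shows "w \<in> span ((\<lambda>j. (G ^^ j) (G e)) ` {..<m}) \<longleftrightarrow>
    (\<exists>q\<in>normalized_polys m. \<forall>i.
      column i S \<bullet> (e - w) = poly q (mu i) * (column i S \<bullet> e))"
    (is "?L \<longleftrightarrow> ?R")
proof -
  have power: "column i S \<bullet> (G ^^ j) (G e) = mu i ^ Suc j * (column i S \<bullet> e)" for i j
    by (induction j) (simp_all add: G)
  show ?thesis
  proof
    assume L: ?L
    \<comment> \<open>Unlike the errors \<open>e - w\<close>, whose polynomials have value \<open>1\<close> at \<open>0\<close>, the \<open>w\<close> form a subspace.\<close>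
    define T where "T = {w. \<exists>q. degree q \<le> m \<and> poly q 0 = 0 \<and>
      (\<forall>i. column i S \<bullet> w = poly q (mu i) * (column i S \<bullet> e))}"
    have "subspace T"
      unfolding subspace_def
    proof (intro conjI ballI allI)
      show "0 \<in> T"
        unfolding T_def by (auto intro: exI[of _ 0])
    next
      fix u v assume "u \<in> T" "v \<in> T"
      then obtain q q' where "degree q \<le> m" "poly q 0 = 0"
        "\<forall>i. column i S \<bullet> u = poly q (mu i) * (column i S \<bullet> e)"
        "degree q' \<le> m" "poly q' 0 = 0"
        "\<forall>i. column i S \<bullet> v = poly q' (mu i) * (column i S \<bullet> e)"
        unfolding T_def by blast
      then show "u + v \<in> T"
        unfolding T_def
        by (auto intro!: exI[of _ "q + q'"] degree_add_le
            simp: inner_add_right algebra_simps)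
    next
      fix c v assume "v \<in> T"
      then obtain q where "degree q \<le> m" "poly q 0 = 0"
        "\<forall>i. column i S \<bullet> v = poly q (mu i) * (column i S \<bullet> e)"
        unfolding T_def by blast
      then show "c *\<^sub>R v \<in> T"
        unfolding T_def
        by (auto intro!: exI[of _ "smult c q"] order_trans[OF degree_smult_le]
            simp: mult.assoc)
    qed
    moreover have "(G ^^ j) (G e) \<in> T" if "j < m" for j
      using that unfolding T_def
      by (auto intro!: exI[of _ "monom 1 (Suc j)"] order_trans[OF degree_monom_le]
          simp: power poly_monom)
    ultimately have "span ((\<lambda>j. (G ^^ j) (G e)) ` {..<m}) \<subseteq> T"
      by (intro span_minimal) auto
    with L obtain q where "degree q \<le> m" "poly q 0 = 0"
      "\<forall>i. column i S \<bullet> w = poly q (mu i) * (column i S \<bullet> e)"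
      unfolding T_def by blast
    then show ?R
      by (intro bexI[of _ "1 - q"])
        (auto simp: normalized_polys_def inner_diff_right left_diff_distrib intro: degree_diff_le)
  next
    assume ?R
    then obtain q where q: "degree q \<le> m" "poly q 0 = 1"
      and ew: "\<And>i. column i S \<bullet> (e - w) = poly q (mu i) * (column i S \<bullet> e)"
      by (auto simp: normalized_polys_def)
    have poly_q: "poly q t = 1 + (\<Sum>j<m. coeff q (Suc j) * t ^ Suc j)" for t
    proof -
      have "poly q t = poly (\<Sum>j\<le>m. monom (coeff q j) j) t"
        by (simp only: poly_as_sum_of_monoms'[OF q(1)])
      also have "\<dots> = (\<Sum>j<Suc m. coeff q j * t ^ j)"
        by (simp add: poly_sum poly_monom lessThan_Suc_atMost)
      also have "\<dots> = coeff q 0 + (\<Sum>j<m. coeff q (Suc j) * t ^ Suc j)"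
        by (simp only: sum.lessThan_Suc_shift power_0 mult_1_right)
      finally show ?thesis
        using q(2) by (simp add: poly_0_coeff_0)
    qed
    have "w = (\<Sum>j<m. (- coeff q (Suc j)) *\<^sub>R (G ^^ j) (G e))"
    proof (rule spectral_coordinates_eqI[OF S])
      fix i
      have "column i S \<bullet> w = (column i S \<bullet> e) - (column i S \<bullet> (e - w))"
        by (simp add: inner_diff_right)
      also have "\<dots> = (1 - poly q (mu i)) * (column i S \<bullet> e)"
        by (simp only: ew left_diff_distrib mult_1)
      also have "\<dots> = (\<Sum>j<m. - coeff q (Suc j) * (column i S \<bullet> (G ^^ j) (G e)))"
        by (simp add: poly_q power sum_distrib_right sum_negf mult.assoc)
      also have "\<dots> = column i S \<bullet> (\<Sum>j<m. (- coeff q (Suc j)) *\<^sub>R (G ^^ j) (G e))"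
        by (simp add: inner_sum_right)
      finally show "column i S \<bullet> w =
        column i S \<bullet> (\<Sum>j<m. (- coeff q (Suc j)) *\<^sub>R (G ^^ j) (G e))" .
    qed
    also have "\<dots> \<in> span ((\<lambda>j. (G ^^ j) (G e)) ` {..<m})"
      by (intro span_sum span_scale span_base) auto
    finally show ?L .
  qed
qed

section \<open>The error of the preconditioned method\<close>

text \<open>The squared energy norm of the error \<open>q(F A)\<close> applied to the initial error, in spectral
  coordinates: the initial error has the coordinates \<open>eta i / lam $ i\<close>, and the energy norm weighs
  their squares by \<open>lam $ i\<close>.\<close>

definition pcg_cost :: "real ^ 'n \<Rightarrow> ('n \<Rightarrow> real) \<Rightarrow> real ^ 'n \<Rightarrow> real poly \<Rightarrow> real"
  where "pcg_cost lam eta d q =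
    (\<Sum>i\<in>UNIV. (eta i)\<^sup>2 / lam $ i * (poly q ((1 + d $ i) * lam $ i))\<^sup>2)"

text \<open>The stored residual and \<open>\<rho>\<close> agree with their definitions in terms of the iterate, also in
  states where the method has stopped. Before step \<open>m\<close> the stopping branch is never taken, since
  \<open>A *v x = b\<close> would force \<open>x = sol\<close> by positivity of \<open>A\<close>.\<close>

lemma pcg_states_run:
  fixes A F :: "real ^ 'n ^ 'n" and b x0 :: "real ^ 'n"
  defines "st \<equiv> \<lambda>j. (pcg_step A F b ^^ j) (pcg_init A F b x0)"
  assumes A: "\<And>u v. (A *v u) \<bullet> v = u \<bullet> (A *v v)" "\<And>v. v \<noteq> 0 \<Longrightarrow> 0 < v \<bullet> (A *v v)"
    and F: "\<And>u v. (F *v u) \<bullet> v = u \<bullet> (F *v v)" "\<And>v. v \<noteq> 0 \<Longrightarrow> 0 < v \<bullet> (F *v v)"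
    and sol: "A *v sol = b"
    and not_solved: "\<And>j. j < m \<Longrightarrow> pcg_iterate A F b x0 j \<noteq> sol"
  shows "pcg_run ((*v) A) ((*v) F) sol (\<lambda>j. fst (st j)) (\<lambda>j. fst (snd (st j)))
    (\<lambda>j. snd (snd (snd (st j)))) m"
proof -
  have unsolved: "A *v fst (st j) \<noteq> b" if "j < m" for j
  proof
    assume "A *v fst (st j) = b"
    then have "A *v (sol - fst (st j)) = 0"
      by (simp add: sol matrix_vector_mult_diff_distrib)
    then have "sol - fst (st j) = 0"
      using A(2)[of "sol - fst (st j)"] by fastforce
    then show False
      using not_solved[OF that] by (simp add: pcg_iterate_def st_def)
  qed
  have st_Suc: "st (Suc j) = pcg_step A F b (st j)" for j
    by (simp add: st_def)
  have residual: "fst (snd (st j)) = b - A *v fst (st j)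
      \<and> fst (snd (snd (st j))) = fst (snd (st j)) \<bullet> (F *v fst (snd (st j)))" for j
  proof (induction j)
    case 0
    show ?case by (simp add: st_def pcg_init_def Let_def)
  next
    case (Suc j)
    then show ?case
      unfolding st_Suc
      by (auto simp: pcg_step_def Let_def split_beta matrix_vector_right_distrib
          matrix_vector_mult_scaleR)
  qed
  show ?thesis
  proof
    show "fst (snd (st j)) = A *v (sol - fst (st j))" for j
      using residual[of j] by (simp add: sol matrix_vector_mult_diff_distrib)
    show "fst (st j) \<noteq> sol" if "j < m" for j
      using not_solved[OF that] by (simp add: pcg_iterate_def st_def)
    show "snd (snd (snd (st 0))) = F *v fst (snd (st 0))"
      by (simp add: st_def pcg_init_def Let_def)
    fix j assume j: "j < m"
    show "fst (st (Suc j)) = fst (st j) +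
        (fst (snd (st j)) \<bullet> (F *v fst (snd (st j))) /
         ((A *v snd (snd (snd (st j)))) \<bullet> snd (snd (snd (st j))))) *\<^sub>R snd (snd (snd (st j)))"
      using unsolved[OF j] residual[of j]
      unfolding st_Suc by (simp add: pcg_step_def Let_def split_beta)
    show "snd (snd (snd (st (Suc j)))) = F *v fst (snd (st (Suc j))) +
        (fst (snd (st (Suc j))) \<bullet> (F *v fst (snd (st (Suc j)))) /
         (fst (snd (st j)) \<bullet> (F *v fst (snd (st j))))) *\<^sub>R snd (snd (snd (st j)))"
      using unsolved[OF j] residual[of j]
      unfolding st_Suc by (simp add: pcg_step_def Let_def split_beta)
  qed (use A F in \<open>auto simp: matrix_vector_right_distrib matrix_vector_mult_scaleR\<close>)
qed

lemma spectral_self_adjoint_posdef: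
  fixes S M :: "real ^ 'n ^ 'n"
  assumes S: "orthogonal_matrix S"
    and M: "\<And>i v. column i S \<bullet> (M *v v) = mu i * (column i S \<bullet> v)"
    and mu: "\<And>i. 0 < mu i"
  shows "(M *v u) \<bullet> v = u \<bullet> (M *v v)"
    and "v \<noteq> 0 \<Longrightarrow> 0 < v \<bullet> (M *v v)"
proof -
  show "(M *v u) \<bullet> v = u \<bullet> (M *v v)"
    by (simp add: inner_spectral_coordinates[OF S, of "M *v u"]
        inner_spectral_coordinates[OF S, of u "M *v v"] M algebra_simps)
  assume "v \<noteq> 0"
  then obtain i where i: "column i S \<bullet> v \<noteq> 0"
    using spectral_coordinates_eqI[OF S, of v 0] by auto
  have "v \<bullet> (M *v v) = (\<Sum>i\<in>UNIV. mu i * (column i S \<bullet> v)\<^sup>2)"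
    by (simp add: inner_spectral_coordinates[OF S, of v] M power2_eq_square algebra_simps)
  also have "\<dots> > 0"
    using i mu by (intro sum_pos2[of _ i]) (auto simp: less_imp_le)
  finally show "0 < v \<bullet> (M *v v)" .
qed

lemma energy_norm_spectral:
  fixes A S :: "real ^ 'n ^ 'n"
  assumes S: "orthogonal_matrix S"
    and A: "A = S ** diag lam ** transpose S"
    and lam: "\<And>i. 0 < lam $ i"
  shows "(energy_norm A v)\<^sup>2 = (\<Sum>i\<in>UNIV. lam $ i * (column i S \<bullet> v)\<^sup>2)"
proof -
  have "v \<bullet> (A *v v) = (\<Sum>i\<in>UNIV. lam $ i * (column i S \<bullet> v)\<^sup>2)"
    by (simp add: inner_spectral_coordinates[OF S, of v] A
        spectral_coordinates_conjugated_diag[OF S] power2_eq_square algebra_simps)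
  moreover have "\<dots> \<ge> 0"
    using lam by (intro sum_nonneg) (simp add: less_imp_le)
  ultimately show ?thesis
    by (simp add: energy_norm_def)
qed

text \<open>Membership of the iterate in the Krylov space provides the polynomial \<open>q\<close>. For minimality, every
  competing polynomial is realised by a point of the affine Krylov space, where the error is no smaller.\<close>

theorem pcg_error_is_minimal_cost:
  fixes A S :: "real ^ 'n ^ 'n"
  assumes S: "orthogonal_matrix S"
    and A: "A = S ** diag lam ** transpose S"
    and lam: "\<And>i. 0 < lam $ i"
    and d: "\<And>i. 0 < 1 + d $ i"
    and sol: "A *v sol = b"
    and eta: "\<And>i. eta i = column i S \<bullet> (b - A *v x0)"
    and not_solved: "\<And>j. j < m \<Longrightarrow> pcg_iterate A (precond S d) b x0 j \<noteq> sol"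
  shows "\<exists>q. is_arg_min (pcg_cost lam eta d) (\<lambda>q. q \<in> normalized_polys m) q \<and>
    (energy_norm A (sol - pcg_iterate A (precond S d) b x0 m))\<^sup>2 = pcg_cost lam eta d q"
proof -
  define F where "F = precond S d"
  define st where "st = (\<lambda>j. (pcg_step A F b ^^ j) (pcg_init A F b x0))"
  define mu where "mu i = (1 + d $ i) * lam $ i" for i
  define K where "K = span ((\<lambda>j. ((\<lambda>u. F *v (A *v u)) ^^ j) (F *v (A *v (sol - x0)))) ` {..<m})"
  have A_coord: "column i S \<bullet> (A *v v) = lam $ i * (column i S \<bullet> v)" for i v
    unfolding A by (rule spectral_coordinates_conjugated_diag[OF S])
  have F_coord: "column i S \<bullet> (F *v v) = (1 + d $ i) * (column i S \<bullet> v)" for i v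
    unfolding F_def by (rule spectral_coordinates_precond[OF S])
  have A_pos: "v \<noteq> 0 \<Longrightarrow> 0 < v \<bullet> (A *v v)" for v
    by (rule spectral_self_adjoint_posdef(2)[OF S A_coord lam])
  interpret pcg_run "(*v) A" "(*v) F" sol "\<lambda>j. fst (st j)" "\<lambda>j. fst (snd (st j))"
    "\<lambda>j. snd (snd (snd (st j)))" m
    unfolding st_def
    by (rule pcg_states_run[OF spectral_self_adjoint_posdef(1)[OF S A_coord lam] A_pos
          spectral_self_adjoint_posdef[OF S F_coord d] sol])
      (use not_solved in \<open>auto simp: F_def\<close>)
  have st_0: "fst (st 0) = x0" "fst (snd (st 0)) = A *v (sol - x0)"
    by (simp_all add: st_def pcg_init_def Let_def sol matrix_vector_mult_diff_distrib)
  have iterate: "pcg_iterate A (precond S d) b x0 m = fst (st m)"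
    by (simp add: pcg_iterate_def st_def F_def)
  have in_K: "fst (st m) - x0 \<in> K"
    using iterate_in_krylov by (simp add: K_def st_0)
  have K_iff: "w \<in> K \<longleftrightarrow> (\<exists>q\<in>normalized_polys m. \<forall>i.
      column i S \<bullet> ((sol - x0) - w) = poly q (mu i) * (column i S \<bullet> (sol - x0)))" for w
    unfolding K_def
    by (rule krylov_iff_normalized_poly[OF S]) (simp add: F_coord A_coord mu_def)
  have eta_coord: "column i S \<bullet> (sol - x0) = eta i / lam $ i" for i
  proof -
    have "eta i = column i S \<bullet> (A *v (sol - x0))"
      by (simp add: eta sol matrix_vector_mult_diff_distrib)
    then show ?thesis
      using lam[of i] by (simp add: A_coord)
  qed
  have cost: "(energy_norm A (sol - v))\<^sup>2 = pcg_cost lam eta d q"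
    if "\<And>i. column i S \<bullet> (sol - v) = poly q (mu i) * (column i S \<bullet> (sol - x0))" for v q
  proof -
    have "lam $ i * (column i S \<bullet> (sol - v))\<^sup>2 = (eta i)\<^sup>2 / lam $ i * (poly q (mu i))\<^sup>2" for i
      using lam[of i] by (simp add: that eta_coord power2_eq_square field_simps)
    then show ?thesis
      by (simp add: energy_norm_spectral[OF S A lam] pcg_cost_def mu_def)
  qed
  obtain q where q: "q \<in> normalized_polys m"
    "\<And>i. column i S \<bullet> (sol - fst (st m)) = poly q (mu i) * (column i S \<bullet> (sol - x0))"
    using in_K K_iff[of "fst (st m) - x0"] by auto
  have energy_sq: "(energy_norm A v)\<^sup>2 = v \<bullet> (A *v v)" for v
    using A_pos[of v] by (cases "v = 0") (auto simp: energy_norm_def)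
  have "pcg_cost lam eta d q \<le> pcg_cost lam eta d q'" if q': "q' \<in> normalized_polys m" for q'
  proof -
    \<comment> \<open>The vector with the coordinates that \<open>q'\<close> prescribes for an error.\<close>
    define err where "err = S *v (\<chi> i. poly q' (mu i) * (column i S \<bullet> (sol - x0)))"
    define v where "v = sol - err"
    have "column i S \<bullet> err = poly q' (mu i) * (column i S \<bullet> (sol - x0))" for i
      by (simp add: err_def spectral_coordinates_mult_vec[OF S])
    then have coord: "column i S \<bullet> (sol - v) = poly q' (mu i) * (column i S \<bullet> (sol - x0))" for i
      by (simp add: v_def)
    then have "v - x0 \<in> K"
      using q' by (auto simp: K_iff)
    then have "(energy_norm A (sol - fst (st m)))\<^sup>2 \<le> (energy_norm A (sol - v))\<^sup>2"
      using iterate_minimizes_energy[of v] by (simp add: energy_sq K_def st_0)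
    then show ?thesis
      by (simp only: cost[OF q(2)] cost[OF coord])
  qed
  then show ?thesis
    using q cost[OF q(2)] by (auto simp: is_arg_min_linorder iterate)
qed

section \<open>Feasible preconditioners\<close>

lemma rank_diag:
  fixes d :: "real ^ 'n"
  shows "rank (diag d) = card {i. d $ i \<noteq> 0}"
proof -
  have "range (\<lambda>v. diag d *v v) = {v. \<forall>i. i \<notin> {i. d $ i \<noteq> 0} \<longrightarrow> v $ i = 0}"
  proof (intro equalityI subsetI)
    fix v :: "real ^ 'n" assume "v \<in> {v. \<forall>i. i \<notin> {i. d $ i \<noteq> 0} \<longrightarrow> v $ i = 0}"
    then have "v = diag d *v (\<chi> i. v $ i / d $ i)"
      by (auto simp: vec_eq_iff diag_mult_vec)
    then show "v \<in> range (\<lambda>v. diag d *v v)" by blast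
  qed (auto simp: diag_mult_vec)
  then show ?thesis
    by (simp only: rank_dim_range dim_substandard_cart flip: dim_vec_eq)
qed

lemma sym_posdef_diag_shift_iff:
  fixes d :: "real ^ 'n"
  shows "sym_posdef (mat 1 + diag d) \<longleftrightarrow> (\<forall>i. 0 < 1 + d $ i)"
proof -
  have mult: "((mat 1 + diag d) *v v) $ i = (1 + d $ i) * v $ i" for v i
    by (simp add: matrix_vector_mult_add_rdistrib diag_mult_vec distrib_right)
  have sym: "transpose (mat 1 + diag d) = mat 1 + diag d"
    by (simp add: transpose_def mat_def diag_def vec_eq_iff)
  show ?thesis
  proof
    assume pd: "sym_posdef (mat 1 + diag d)"
    show "\<forall>i. 0 < 1 + d $ i"
    proof
      fix i
      have "(axis i 1 :: real ^ 'n) \<noteq> 0"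
        by (simp add: axis_eq_0_iff)
      then have "0 < axis i 1 \<bullet> ((mat 1 + diag d) *v axis i 1)"
        using pd by (auto simp: sym_posdef_def)
      then show "0 < 1 + d $ i"
        by (simp only: inner_axis' mult) simp
    qed
  next
    assume pos: "\<forall>i. 0 < 1 + d $ i"
    have "0 < v \<bullet> ((mat 1 + diag d) *v v)" if v: "v \<noteq> 0" for v
    proof -
      obtain i where "v $ i \<noteq> 0"
        using v by (auto simp: vec_eq_iff)
      then have "0 < (\<Sum>i\<in>UNIV. (1 + d $ i) * (v $ i)\<^sup>2)"
        using pos by (intro sum_pos2[of _ i]) (auto simp: less_imp_le)
      then show ?thesis
        by (simp only: inner_vec_def mult) (simp add: power2_eq_square algebra_simps)
    qed
    then show "sym_posdef (mat 1 + diag d)"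
      by (simp add: sym_posdef_def sym)
  qed
qed

lemma feasible_iff:
  "feasible k d \<longleftrightarrow> (\<forall>i. 0 < 1 + d $ i) \<and> card {i. d $ i \<noteq> 0} \<le> k"
  by (simp add: feasible_def sym_posdef_diag_shift_iff rank_diag)

text \<open>Off \<open>I\<close> the eigenvalues are unchanged, and the terms indexed by \<open>I\<close> are nonnegative.\<close>

lemma spectral_cost_le_pcg_cost:
  assumes lam: "\<And>i. 0 < lam $ i" and I: "\<And>i. d $ i \<noteq> 0 \<Longrightarrow> i \<in> I"
  shows "spectral_cost lam eta (- I) q \<le> pcg_cost lam eta d q"
proof -
  have "spectral_cost lam eta (- I) q =
      (\<Sum>i\<in>- I. (eta i)\<^sup>2 / lam $ i * (poly q ((1 + d $ i) * lam $ i))\<^sup>2)"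
    unfolding spectral_cost_def
  proof (rule sum.cong)
    fix i assume "i \<in> - I"
    then have "d $ i = 0" using I by blast
    then show "(eta i)\<^sup>2 / lam $ i * (poly q (lam $ i))\<^sup>2 =
        (eta i)\<^sup>2 / lam $ i * (poly q ((1 + d $ i) * lam $ i))\<^sup>2"
      by simp
  qed simp
  also have "\<dots> \<le> pcg_cost lam eta d q"
    unfolding pcg_cost_def using lam by (intro sum_mono2) (auto simp: less_imp_le)
  finally show ?thesis .
qed

text \<open>The factor \<open>1 + d $ i = theta / lam $ i\<close> sends the eigenvalue \<open>lam $ i\<close> to the root \<open>theta\<close>.\<close>

lemma pcg_cost_clustered:
  assumes "poly q theta = 0" and lam: "\<And>i. 0 < lam $ i"
  shows "pcg_cost lam eta (\<chi> i. if i \<in> I then theta / lam $ i - 1 else 0) q =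
    spectral_cost lam eta (- I) q"
  unfolding pcg_cost_def spectral_cost_def
  using assms lam[THEN less_imp_neq]
  by (intro sum.mono_neutral_cong_right) (auto simp: field_simps)

lemma min_value_eq:
  assumes "is_arg_min f (\<lambda>x. x \<in> X) (a :: 'a)"
  shows "min_value f X = (f a :: real)"
  unfolding min_value_def
  using assms by (intro Least_equality) (auto simp: is_arg_min_linorder)

section \<open>The optimal preconditioner\<close>

theorem theorem3p3:
  fixes A S :: "real ^ ('n::{finite,linorder}) ^ ('n::{finite,linorder})"
    and lam b x0 r0 xstar dstar :: "real ^ ('n::{finite,linorder})"
    and eta :: "'n \<Rightarrow> real"
    and k l :: nat
    and pistar :: "'n set"
    and phat :: "real poly"
    and theta :: real
  assumes A_posdef: "sym_posdef A"
    and S_orth: "orthogonal_matrix S"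
    and spectral: "A = S ** diag lam ** transpose S"
    and lam_sorted: "\<And>i j. i \<le> j \<Longrightarrow> lam $ j \<le> lam $ i"
    and lam_pos: "\<And>i. 0 < lam $ i"
    and xstar: "xstar = matrix_inv A *v b"
    and r0: "r0 = b - A *v x0"
    and eta: "\<And>i. eta i = column i S \<bullet> r0"
    and k: "1 < k" "k < CARD('n)"
    and l: "1 \<le> l"
    and not_reached: "\<And>d j. feasible k d \<Longrightarrow> j \<le> l \<Longrightarrow>
          pcg_iterate A (precond S d) b x0 j \<noteq> xstar"
    and pistar: "is_arg_min
          (\<lambda>I. min_value (spectral_cost lam eta (- I)) (normalized_polys l))
          (\<lambda>I. card I = k) pistar"
    and phat: "{p. is_arg_min (spectral_cost lam eta (- pistar))
          (\<lambda>p. p \<in> normalized_polys l) p} = {phat}"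
    and theta: "0 < theta" "poly phat theta = 0"
    and dstar: "dstar = (\<chi> i. if i \<in> pistar then theta / lam $ i - 1 else 0)"
  shows "is_arg_min
          (\<lambda>d. 1 / 2 * (energy_norm A (xstar - pcg_iterate A (precond S d) b x0 l))\<^sup>2)
          (feasible k) dstar
       \<and> (energy_norm A (xstar - pcg_iterate A (precond S dstar) b x0 l))\<^sup>2
          = (\<Sum>i\<in>- pistar. (eta i)\<^sup>2 / lam $ i * (poly phat (lam $ i))\<^sup>2)"
proof -
  have coord_A: "column i S \<bullet> (A *v v) = lam $ i * (column i S \<bullet> v)" for i v
    unfolding spectral by (rule spectral_coordinates_conjugated_diag[OF S_orth])
  have A_inj: "inj ((*v) A)"
  proof (rule injI)
    fix u v assume "A *v u = A *v v"
    then have "column i S \<bullet> u = column i S \<bullet> v" for i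
      using coord_A[of i u] coord_A[of i v] lam_pos[of i] by simp
    then show "u = v" by (rule spectral_coordinates_eqI[OF S_orth])
  qed
  then have "invertible A"
    by (simp add: invertible_left_inverse matrix_left_invertible_injective)
  then have "A ** matrix_inv A = mat 1"
    unfolding invertible_def matrix_inv_def by (rule someI2_ex) simp
  then have sol: "A *v xstar = b"
    by (simp add: xstar matrix_vector_mul_assoc)
  define err where "err d = (energy_norm A (xstar - pcg_iterate A (precond S d) b x0 l))\<^sup>2" for d
  have err: "\<exists>q. is_arg_min (pcg_cost lam eta d) (\<lambda>q. q \<in> normalized_polys l) q
      \<and> err d = pcg_cost lam eta d q" if "feasible k d" for d
    unfolding err_def
    by (rule pcg_error_is_minimal_cost[OF S_orth spectral lam_pos _ sol])
      (use that not_reached[OF that] in \<open>auto simp: feasible_iff eta r0\<close>)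
  have phat_min: "is_arg_min (spectral_cost lam eta (- pistar)) (\<lambda>q. q \<in> normalized_polys l) phat"
    using phat by auto
  have card_pistar: "card pistar = k"
    using pistar by (simp add: is_arg_min_def)
  define opt where "opt = spectral_cost lam eta (- pistar) phat"
  have lower: "opt \<le> err d" if d: "feasible k d" for d
  proof -
    obtain q where q: "q \<in> normalized_polys l" "err d = pcg_cost lam eta d q"
      using err[OF d] by (auto simp: is_arg_min_def)
    have "card {i. d $ i \<noteq> 0} \<le> k"
      using d by (simp add: feasible_iff)
    \<comment> \<open>\<open>pistar\<close> competes with sets of exactly \<open>k\<close> elements, so the support has to be padded.\<close>
    then obtain I where I: "{i. d $ i \<noteq> 0} \<subseteq> I" "card I = k"
      using exists_subset_between[of "{i. d $ i \<noteq> 0}" k UNIV] k(2) by auto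
    obtain p where p: "is_arg_min (spectral_cost lam eta (- I)) (\<lambda>q. q \<in> normalized_polys l) p"
      using spectral_cost_attains_min[OF lam_pos] by blast
    have "opt = min_value (spectral_cost lam eta (- pistar)) (normalized_polys l)"
      by (simp add: opt_def min_value_eq[OF phat_min])
    also have "\<dots> \<le> min_value (spectral_cost lam eta (- I)) (normalized_polys l)"
      using pistar I(2) by (simp add: is_arg_min_linorder)
    also have "\<dots> = spectral_cost lam eta (- I) p"
      by (rule min_value_eq[OF p])
    also have "\<dots> \<le> spectral_cost lam eta (- I) q"
      using p q(1) by (simp add: is_arg_min_linorder)
    also have "\<dots> \<le> err d"
      unfolding q(2) using I(1) by (intro spectral_cost_le_pcg_cost lam_pos) auto
    finally show ?thesis .
  qed
  have "card {i. dstar $ i \<noteq> 0} \<le> k"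
    unfolding card_pistar[symmetric] by (rule card_mono) (auto simp: dstar)
  then have feas: "feasible k dstar"
    using theta(1) lam_pos by (auto simp: feasible_iff dstar)
  have "err dstar \<le> pcg_cost lam eta dstar phat"
    using err[OF feas] phat_min by (auto simp: is_arg_min_linorder)
  also have "\<dots> = opt"
    unfolding dstar opt_def by (rule pcg_cost_clustered[OF theta(2) lam_pos])
  finally have eq: "err dstar = opt"
    using lower[OF feas] by simp
  show ?thesis
    using lower feas eq
    by (auto simp: is_arg_min_linorder opt_def spectral_cost_def simp flip: err_def)
qed

end
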